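(* Let $(X,\mathcal T)$ be a nonempty topological space with topological (covering) dimension ${\rm dim}(X) = \infty$. Then there do not exist a quasimetric $\rho$ on $X$ and a Borel measure $\mu$ on $X$ such that $\mathcal T_\rho = \mathcal T$ and $(X,\rho,\mu)$ is homogeneous in the Coifman--Weiss sense.
   Context: Topological dimension: for a nonempty topological space $(X,\mathcal T)$, ${\rm dim}(X)$ is the smallest $n \in \{0,1,2,\dots\}$ such that each open cover $\mathcal B$ of $X$ has a refinement $\tilde{\mathcal B}$ (a second open cover of $X$ each of whose elements is a subset of some element of $\mathcal B$) such that each point $x\in X$ belongs to no more than $n+1$ elements of $\tilde{\mathcal B}$. If no such $n$ exists, ${\rm dim}(X)=\infty$. Quasimetric: a mapping $\rho\colon X\times X\to[0,\infty)$ on a nonempty set $X$ such that $\rho(x,y)=0$ if and only if $x=y$; $\rho(x,y)=\rho(y,x)$; and there is a constant $K\in[1,\infty)$ with $\rho(x,y)\le K(\rho(x,z)+\rho(z,y))$ for all $x,y,z\in X$. Balls and topology: $B_\rho(x,r)=\{y\in X:\rho(x,y)<r\}$ for $x\in X$, $r\in(0,\infty)$. The topology $\mathcal T_\rho$ consists of all sets $G\subset X$ such that for each $x\in G$ there is $r_x\in(0,\infty)$ with $B_\rho(x,r_x)\subset G$. (Balls need not be open, or even Borel, with respect to $\mathcal T_\rho$.) Homogeneity: given a nonempty set $X$, a quasimetric $\rho$ on $X$, and a Borel measure $\mu$ (Borel with respect to $\mathcal T_\rho$), the space $(X,\rho,\mu)$ is homogeneous in the Coifman--Weiss sense if all balls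 are $\mu$-measurable, $\mu(B_\rho(x,r))\in(0,\infty)$ for all $x \in X$, $r\in(0,\infty)$, and there exists a constant $C\in[1,\infty)$ such that $\mu(B_\rho(x,2r))\le C\mu(B_\rho(x,r))$ for all $x\in X$, $r\in(0,\infty)$. *)

theory Defs
  imports "HOL-Analysis.Analysis" "HOL-Library.Extended_Nat"
begin

definition open_cover :: "'a topology \<Rightarrow> 'a set set \<Rightarrow> bool" where
  "open_cover T \<B> \<longleftrightarrow> (\<forall>U\<in>\<B>. openin T U) \<and> \<Union>\<B> = topspace T"

definition open_refinement :: "'a topology \<Rightarrow> 'a set set \<Rightarrow> 'a set set \<Rightarrow> bool" where
  "open_refinement T \<B> \<C> \<longleftrightarrow> open_cover T \<C> \<and> (\<forall>V\<in>\<C>. \<exists>U\<in>\<B>. V \<subseteq> U)"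

text \<open>The finiteness requirement is needed because \<^const>\<open>card\<close> of an infinite set is 0.\<close>

definition covering_dim_le :: "'a topology \<Rightarrow> nat \<Rightarrow> bool" where
  "covering_dim_le T n \<longleftrightarrow>
    (\<forall>\<B>. open_cover T \<B> \<longrightarrow>
      (\<exists>\<C>. open_refinement T \<B> \<C> \<and>
        (\<forall>x\<in>topspace T. finite {V\<in>\<C>. x \<in> V} \<and> card {V\<in>\<C>. x \<in> V} \<le> n + 1)))"

definition covering_dim :: "'a topology \<Rightarrow> enat" where
  "covering_dim T =
    (if \<exists>n. covering_dim_le T n then enat (LEAST n. covering_dim_le T n) else \<infinity>)"

text \<open>A quasimetric is a function on the whole type; only its values on the carrier \<open>X\<close> matter.\<close>

definition quasimetric_on :: "'a set \<Rightarrow> ('a \<Rightarrow> 'a \<Rightarrow> real) \<Rightarrow> bool" where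
  "quasimetric_on X \<rho> \<longleftrightarrow>
    X \<noteq> {} \<and>
    (\<forall>x\<in>X. \<forall>y\<in>X. 0 \<le> \<rho> x y) \<and>
    (\<forall>x\<in>X. \<forall>y\<in>X. \<rho> x y = 0 \<longleftrightarrow> x = y) \<and>
    (\<forall>x\<in>X. \<forall>y\<in>X. \<rho> x y = \<rho> y x) \<and>
    (\<exists>K\<ge>1. \<forall>x\<in>X. \<forall>y\<in>X. \<forall>z\<in>X. \<rho> x y \<le> K * (\<rho> x z + \<rho> z y))"

definition qball :: "'a set \<Rightarrow> ('a \<Rightarrow> 'a \<Rightarrow> real) \<Rightarrow> 'a \<Rightarrow> real \<Rightarrow> 'a set" where
  "qball X \<rho> x r = {y\<in>X. \<rho> x y < r}"

definition qtopology :: "'a set \<Rightarrow> ('a \<Rightarrow> 'a \<Rightarrow> real) \<Rightarrow> 'a topology" where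
  "qtopology X \<rho> = topology (\<lambda>G. G \<subseteq> X \<and> (\<forall>x\<in>G. \<exists>r>0. qball X \<rho> x r \<subseteq> G))"

lemma openin_qtopology:
  "openin (qtopology X \<rho>) G \<longleftrightarrow> G \<subseteq> X \<and> (\<forall>x\<in>G. \<exists>r>0. qball X \<rho> x r \<subseteq> G)"
proof -
  let ?P = "\<lambda>G. G \<subseteq> X \<and> (\<forall>x\<in>G. \<exists>r>0. qball X \<rho> x r \<subseteq> G)"
  have "?P (S \<inter> S')" if S: "?P S" and S': "?P S'" for S S'
  proof (intro conjI ballI)
    show "S \<inter> S' \<subseteq> X" using S by blast
    fix x assume x: "x \<in> S \<inter> S'"
    obtain r where r: "r > 0" "qball X \<rho> x r \<subseteq> S" using S x by blast
    obtain r' where r': "r' > 0" "qball X \<rho> x r' \<subseteq> S'" using S' x by blast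
    have "min r r' > 0" "qball X \<rho> x (min r r') \<subseteq> S \<inter> S'"
      using r r' by (auto simp: qball_def)
    then show "\<exists>r>0. qball X \<rho> x r \<subseteq> S \<inter> S'" by blast
  qed
  moreover have "?P (\<Union>\<K>)" if K: "\<forall>S\<in>\<K>. ?P S" for \<K>
  proof (intro conjI ballI)
    show "\<Union>\<K> \<subseteq> X" using K by blast
    fix x assume "x \<in> \<Union>\<K>"
    then obtain S where S: "S \<in> \<K>" "x \<in> S" by blast
    then obtain r where "r > 0" "qball X \<rho> x r \<subseteq> S" using K by blast
    then show "\<exists>r>0. qball X \<rho> x r \<subseteq> \<Union>\<K>" using S(1) by blast
  qed
  ultimately have "istopology ?P" unfolding istopology_def by blast
  then show ?thesis by (simp add: qtopology_def)
qed

lemma topspace_qtopology [simp]: "topspace (qtopology X \<rho>) = X"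
proof
  show "topspace (qtopology X \<rho>) \<subseteq> X"
    using openin_topspace[of "qtopology X \<rho>"] by (simp only: openin_qtopology)
  have "openin (qtopology X \<rho>) X"
    unfolding openin_qtopology by (auto simp: qball_def intro: exI[of _ "1::real"])
  then show "X \<subseteq> topspace (qtopology X \<rho>)" by (rule openin_subset)
qed

text \<open>A Borel measure lives on some sigma-algebra containing the Borel sets.  The
  sigma-algebra may be larger: balls need not be Borel, so measurability of balls is
  a genuine condition on the measure (balls may, for instance, belong only to the completion).\<close>

definition borel_measure_on :: "'a topology \<Rightarrow> 'a measure \<Rightarrow> bool" where
  "borel_measure_on T M \<longleftrightarrow>
    space M = topspace T \<and> sigma_sets (topspace T) {U. openin T U} \<subseteq> sets M"

definition cw_homogeneous :: "'a set \<Rightarrow> ('a \<Rightarrow> 'a \<Rightarrow> real) \<Rightarrow> 'a measure \<Rightarrow> bool" where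
  "cw_homogeneous X \<rho> M \<longleftrightarrow>
    quasimetric_on X \<rho> \<and>
    borel_measure_on (qtopology X \<rho>) M \<and>
    (\<forall>x\<in>X. \<forall>r>0. qball X \<rho> x r \<in> sets M) \<and>
    (\<forall>x\<in>X. \<forall>r>0. 0 < emeasure M (qball X \<rho> x r) \<and> emeasure M (qball X \<rho> x r) < \<infinity>) \<and>
    (\<exists>C::real. C \<ge> 1 \<and> (\<forall>x\<in>X. \<forall>r>0.
      emeasure M (qball X \<rho> x (2 * r)) \<le> ennreal C * emeasure M (qball X \<rho> x r)))"

end

theory Submission
  imports Defs
begin

text \<open>A doubling measure bounds the number of points of a ball that are separated at a scale
  proportional to its radius. For an open cover let \<open>r x \<le> 1\<close> be the supremal radius of a ball
  around \<open>x\<close> inside a member of the cover; \<open>r\<close> varies by at most a constant factor on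
  balls \<open>B(x, r x / (2 * K))\<close>. The balls of radius comparable to \<open>r x\<close> around the points of a
  maximal set separated at scale \<open>r\<close> therefore form a Whitney-type refinement whose
  multiplicity does not depend on the cover.\<close>

section \<open>Maximal sets for a symmetric relation\<close>

text \<open>Zorn's lemma applies since pairwise conditions pass to unions of chains. Symmetry turns
  a failure to enlarge \<open>S\<close> by \<open>y\<close> into a single \<open>x\<close> in
  \<open>S\<close> with \<open>R x y\<close> false.\<close>

lemma maximal_pairwise_subset:
  assumes "symp R"
  shows "\<exists>S\<subseteq>X. pairwise R S \<and> (\<forall>y\<in>X - S. \<exists>x\<in>S. \<not> R x y)"
proof -
  let ?A = "{S. S \<subseteq> X \<and> pairwise R S}"
  have "\<exists>S\<in>?A. \<forall>S'\<in>?A. S \<subseteq> S' \<longrightarrow> S' = S"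
  proof (rule subset_Zorn')
    fix \<C> assume c: "subset.chain ?A \<C>"
    then have "\<Union>\<C> \<subseteq> X" unfolding subset_chain_def by blast
    moreover have "pairwise R (\<Union>\<C>)"
      using c by (intro pairwise_chain_Union) (auto simp: subset_chain_def chain_subset_def)
    ultimately show "\<Union>\<C> \<in> ?A" by simp
  qed
  then obtain S where "S \<in> ?A" and "\<forall>S'\<in>?A. S \<subseteq> S' \<longrightarrow> S' = S"
    by (rule bexE)
  then have S: "S \<subseteq> X" "pairwise R S"
    and max: "S' \<subseteq> X \<Longrightarrow> pairwise R S' \<Longrightarrow> S \<subseteq> S' \<Longrightarrow> S' = S" for S'
    by auto
  have "\<exists>x\<in>S. \<not> R x y" if y: "y \<in> X" "y \<notin> S" for y
  proof (rule ccontr)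
    assume "\<not> (\<exists>x\<in>S. \<not> R x y)"
    then have "pairwise R (insert y S)"
      using S(2) assms by (auto simp: pairwise_insert dest: sympD)
    then show False using max[of "insert y S"] S(1) y by auto
  qed
  with S show ?thesis by (intro exI[of _ S]) simp
qed

section \<open>Balls of a quasimetric and their interiors\<close>

locale quasimetric =
  fixes X :: "'a set" and \<rho> :: "'a \<Rightarrow> 'a \<Rightarrow> real" and K :: real
  assumes K_ge_1: "1 \<le> K"
    and zero_self: "x \<in> X \<Longrightarrow> \<rho> x x = 0"
    and sym: "\<lbrakk>x \<in> X; y \<in> X\<rbrakk> \<Longrightarrow> \<rho> x y = \<rho> y x"
    and triangle: "\<lbrakk>x \<in> X; y \<in> X; z \<in> X\<rbrakk> \<Longrightarrow> \<rho> x y \<le> K * (\<rho> x z + \<rho> z y)"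
begin

abbreviation B :: "'a \<Rightarrow> real \<Rightarrow> 'a set" where "B \<equiv> qball X \<rho>"

lemma ball_subset_ball:
  assumes "x \<in> X" "y \<in> X" "K * (\<rho> x y + s) \<le> r"
  shows "B y s \<subseteq> B x r"
proof
  fix z assume z: "z \<in> B y s"
  then have "z \<in> X" "\<rho> y z < s" by (auto simp: qball_def)
  then have "\<rho> x z \<le> K * (\<rho> x y + \<rho> y z)" using assms triangle by blast
  also have "\<dots> < K * (\<rho> x y + s)" using K_ge_1 \<open>\<rho> y z < s\<close> by simp
  finally show "z \<in> B x r" using assms \<open>z \<in> X\<close> by (simp add: qball_def)
qed

text \<open>The quasi-triangle inequality costs a factor \<open>K\<close> and the sum of two equal
  terms a factor 2. This is the source of every factor \<open>2 * K\<close> in the comparison of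
  radii.\<close>

lemma half_ball_subset_ball:
  assumes "x \<in> X" "y \<in> X" "\<rho> x y \<le> r / (2 * K)"
  shows "B y (r / (2 * K)) \<subseteq> B x r"
proof (rule ball_subset_ball[OF assms(1,2)])
  have "K * (\<rho> x y + r / (2 * K)) \<le> K * (r / (2 * K) + r / (2 * K))"
    using K_ge_1 assms(3) by (intro mult_left_mono) auto
  also have "\<dots> = r" using K_ge_1 by (simp add: field_simps)
  finally show "K * (\<rho> x y + r / (2 * K)) \<le> r" .
qed

text \<open>Balls need not be open; \<open>core x r\<close> is the interior of \<open>B x r\<close>.\<close>

definition core :: "'a \<Rightarrow> real \<Rightarrow> 'a set" where
  "core x r = {y\<in>X. \<exists>s>0. B y s \<subseteq> B x r}"

lemma openin_core: "openin (qtopology X \<rho>) (core x r)"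
  unfolding openin_qtopology
proof (intro conjI ballI)
  show "core x r \<subseteq> X" by (auto simp: core_def)
  fix y assume "y \<in> core x r"
  then obtain s where s: "y \<in> X" "s > 0" "B y s \<subseteq> B x r" by (auto simp: core_def)
  \<comment> \<open>The same shrunken radius serves as the ball around \<open>y\<close> and as the
    witness at every point \<open>z\<close> of it.\<close>
  have pos: "s / (2 * K) > 0" using s K_ge_1 by simp
  have "B y (s / (2 * K)) \<subseteq> core x r"
  proof
    fix z assume "z \<in> B y (s / (2 * K))"
    then have z: "z \<in> X" "\<rho> y z \<le> s / (2 * K)" by (auto simp: qball_def)
    then have "B z (s / (2 * K)) \<subseteq> B x r"
      using half_ball_subset_ball[of y z s] s by blast
    then show "z \<in> core x r" using z pos by (auto simp: core_def)
  qed
  then show "\<exists>r'>0. B y r' \<subseteq> core x r" using pos by blast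
qed

lemma core_subset: "core x r \<subseteq> B x r"
proof
  fix y assume "y \<in> core x r"
  then obtain s where "y \<in> X" "s > 0" "B y s \<subseteq> B x r" by (auto simp: core_def)
  moreover have "y \<in> B y s" using calculation zero_self by (simp add: qball_def)
  ultimately show "y \<in> B x r" by blast
qed

text \<open>Passing from a ball to its interior loses at most the factor \<open>2 * K\<close>, so
  cores can replace balls in an open cover.\<close>

lemma ball_subset_core:
  assumes "x \<in> X" "r > 0"
  shows "B x (r / (2 * K)) \<subseteq> core x r"
proof
  fix y assume "y \<in> B x (r / (2 * K))"
  then have "y \<in> X" "\<rho> x y \<le> r / (2 * K)" by (auto simp: qball_def)
  then show "y \<in> core x r"
    using half_ball_subset_ball[of x y r] assms K_ge_1
    by (auto simp: core_def intro!: exI[of _ "r / (2 * K)"])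
qed

section \<open>Radius function of an open cover\<close>

text \<open>The supremal radius, truncated at 1 because a member of the cover may contain balls of
  every radius.\<close>

definition cover_radius :: "'a set set \<Rightarrow> 'a \<Rightarrow> real" where
  "cover_radius \<B> x = Sup {r. 0 < r \<and> r \<le> 1 \<and> (\<exists>U\<in>\<B>. B x r \<subseteq> U)}"

context
  fixes \<B> assumes cover: "open_cover (qtopology X \<rho>) \<B>"
begin

abbreviation "radii x \<equiv> {r. 0 < r \<and> r \<le> 1 \<and> (\<exists>U\<in>\<B>. B x r \<subseteq> U)}"

lemma bdd_above_radii: "bdd_above (radii x)"
  by (auto simp: bdd_above_def)

lemma radii_nonempty:
  assumes "x \<in> X"
  shows "radii x \<noteq> {}"
proof -
  obtain U where U: "U \<in> \<B>" "x \<in> U" "openin (qtopology X \<rho>) U"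
    using cover assms by (auto simp: open_cover_def)
  then obtain r where "r > 0" "B x r \<subseteq> U" unfolding openin_qtopology by blast
  then have "min r 1 \<in> radii x" using U by (auto simp: qball_def)
  then show ?thesis by blast
qed

lemma cover_radius_upper: "r \<in> radii x \<Longrightarrow> r \<le> cover_radius \<B> x"
  unfolding cover_radius_def by (rule cSup_upper[OF _ bdd_above_radii])

lemma less_cover_radius:
  assumes "x \<in> X" "t < cover_radius \<B> x"
  obtains r where "t < r" "r \<in> radii x"
  by (rule less_cSupE[OF assms(2)[unfolded cover_radius_def] radii_nonempty[OF assms(1)]]) (rule that)

lemma cover_radius_pos:
  assumes "x \<in> X"
  shows "0 < cover_radius \<B> x"
proof -
  obtain r where r: "r \<in> radii x" using radii_nonempty[OF assms] by blast
  then have "0 < r" by simp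
  also have "r \<le> cover_radius \<B> x" by (rule cover_radius_upper[OF r])
  finally show ?thesis .
qed

lemma ball_subset_cover:
  assumes "x \<in> X" "t < cover_radius \<B> x"
  shows "\<exists>U\<in>\<B>. B x t \<subseteq> U"
proof -
  obtain r U where "t < r" "U \<in> \<B>" "B x r \<subseteq> U"
    using less_cover_radius[OF assms] by blast
  moreover have "B x t \<subseteq> B x r" using \<open>t < r\<close> by (auto simp: qball_def)
  ultimately show ?thesis by blast
qed

lemma cover_radius_le:
  assumes "x \<in> X" "y \<in> X" "\<rho> x y < cover_radius \<B> x / (2 * K)"
  shows "cover_radius \<B> x \<le> 2 * K * cover_radius \<B> y"
proof (rule dense_le_bounded)
  show "2 * K * \<rho> x y < cover_radius \<B> x"
    using assms(3) K_ge_1 by (simp add: field_simps)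
  \<comment> \<open>Only \<open>t\<close> close to the supremum matter: above
    \<open>2 * K * \<rho> x y\<close>, an admissible \<open>r\<close> at \<open>x\<close> makes
    \<open>r / (2 * K)\<close> admissible at \<open>y\<close>.\<close>
  fix t assume t: "2 * K * \<rho> x y < t" "t < cover_radius \<B> x"
  then obtain r U where r: "t < r" "0 < r" "r \<le> 1" "U \<in> \<B>" "B x r \<subseteq> U"
    using less_cover_radius[OF assms(1)] by blast
  have "\<rho> x y \<le> r / (2 * K)" using t r K_ge_1 by (simp add: field_simps)
  then have "B y (r / (2 * K)) \<subseteq> U" using half_ball_subset_ball[of x y r] assms r by blast
  moreover have "r / (2 * K) \<le> 1" using r K_ge_1 by (simp add: field_simps)
  ultimately have "r / (2 * K) \<le> cover_radius \<B> y"
    using r K_ge_1 by (intro cover_radius_upper) auto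
  then show "t \<le> 2 * K * cover_radius \<B> y" using r K_ge_1 by (simp add: field_simps)
qed

text \<open>With the maximum, the hypothesis is symmetric in the two points and yields both
  comparisons. If \<open>y\<close> has the larger radius, the bound follows from
  \<open>2 * K \<ge> 1\<close>.\<close>

lemma cover_radius_comparable:
  assumes "x \<in> X" "y \<in> X" "\<rho> x y < max (cover_radius \<B> x) (cover_radius \<B> y) / (2 * K)"
  shows "cover_radius \<B> x \<le> 2 * K * cover_radius \<B> y"
proof (cases "cover_radius \<B> y \<le> cover_radius \<B> x")
  case True
  then show ?thesis using assms cover_radius_le[of x y] by simp
next
  case False
  have "1 * cover_radius \<B> y \<le> 2 * K * cover_radius \<B> y"
    using K_ge_1 cover_radius_pos[of y] assms by (intro mult_right_mono) auto
  then show ?thesis using False by simp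
qed

end

section \<open>Whitney-type refinement and its multiplicity\<close>

definition separated :: "real \<Rightarrow> 'a set \<Rightarrow> bool" where
  "separated \<epsilon> F \<longleftrightarrow> pairwise (\<lambda>x y. \<epsilon> \<le> \<rho> x y) F"

text \<open>The scale \<open>t / (16 * K ^ 4)\<close> arises at \<open>t = r z\<close>: centres are
  separated by \<epsilon> times their radius with \<epsilon> = \<open>1 / (8 * K ^ 3)\<close>, and
  centres whose cores contain \<open>z\<close> have radius at least
  \<open>r z / (2 * K)\<close>.\<close>

lemma covering_dim_le_of_separated_bound:
  assumes bound: "\<And>z t F. \<lbrakk>z \<in> X; 0 < t; F \<subseteq> B z t; separated (t / (16 * K ^ 4)) F\<rbrakk>
      \<Longrightarrow> finite F \<and> card F \<le> N"
  shows "covering_dim_le (qtopology X \<rho>) N"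
  unfolding covering_dim_le_def topspace_qtopology
proof (intro allI impI)
  fix \<B> assume cover: "open_cover (qtopology X \<rho>) \<B>"
  define r where "r = cover_radius \<B>"
  note r_pos = cover_radius_pos[OF cover, folded r_def]
  note r_comparable = cover_radius_comparable[OF cover, folded r_def]
  \<comment> \<open>Chosen so that cores of radius \<open>r x / (2 * K)\<close>, which only contain the balls of
    radius \<open>r x / (2 * K) / (2 * K) = 2 * K * \<epsilon> * r x\<close>, still cover \<open>X\<close>.\<close>
  define \<epsilon> where "\<epsilon> = 1 / (8 * K ^ 3)"
  \<comment> \<open>The maximum makes \<open>R\<close> symmetric. The membership premises extend
    that symmetry to the whole type, since \<open>sym\<close> speaks only of points of
    \<open>X\<close>.\<close>
  define R where "R = (\<lambda>x y. x \<in> X \<longrightarrow> y \<in> X \<longrightarrow> \<epsilon> * max (r x) (r y) \<le> \<rho> x y)"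
  \<comment> \<open>This radius is strictly below \<open>r x\<close>, so the core fits into a member
    of the cover, and it is small enough to make \<open>r\<close> comparable at \<open>x\<close> and
    at any point of \<open>V x\<close>.\<close>
  define V where "V = (\<lambda>x. core x (r x / (2 * K)))"
  have "symp R" unfolding R_def symp_def by (metis max.commute sym)
  obtain S where S: "S \<subseteq> X" "pairwise R S"
    and max: "\<forall>y\<in>X - S. \<exists>x\<in>S. \<not> R x y"
    using maximal_pairwise_subset[OF \<open>symp R\<close>, of X] by (elim exE conjE)
  have eps: "\<epsilon> > 0" "\<epsilon> \<le> 1 / (2 * K)" "2 * K * \<epsilon> = 1 / (2 * K) / (2 * K)"
  proof -
    have "1 \<le> K ^ 2" using K_ge_1 by (rule one_le_power)
    then have "K * 1 \<le> K * (4 * K ^ 2)" using K_ge_1 by (intro mult_left_mono) linarith+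
    then have "2 * K \<le> 8 * K ^ 3" by (simp add: power2_eq_square power3_eq_cube)
    then show "\<epsilon> \<le> 1 / (2 * K)"
      unfolding \<epsilon>_def using K_ge_1 by (intro divide_left_mono) auto
    show "\<epsilon> > 0" using K_ge_1 by (simp add: \<epsilon>_def)
    show "2 * K * \<epsilon> = 1 / (2 * K) / (2 * K)" by (simp add: \<epsilon>_def power3_eq_cube)
  qed
  have covered: "\<exists>x\<in>S. y \<in> V x" if y: "y \<in> X" for y
  proof -
    have "\<exists>x\<in>S. \<rho> x y < 2 * K * \<epsilon> * r x"
    proof (cases "y \<in> S")
      case True
      then show ?thesis using zero_self[OF y] r_pos[OF y] eps(1) K_ge_1
        by (intro bexI[of _ y]) auto
    next
      case False
      \<comment> \<open>Maximality supplies a centre close to \<open>y\<close> relative to the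
        larger of the two radii; comparability then replaces that maximum by
        \<open>2 * K * r x\<close>.\<close>
      then obtain x where x: "x \<in> S" "x \<in> X" "\<rho> x y < \<epsilon> * max (r x) (r y)"
        using max y S(1) unfolding R_def by (metis DiffI not_le)
      have "\<epsilon> * max (r x) (r y) \<le> 1 / (2 * K) * max (r x) (r y)"
        using eps r_pos[OF y] by (intro mult_right_mono) auto
      then have "\<rho> y x < max (r y) (r x) / (2 * K)"
        using x y by (simp add: max.commute sym[of y x])
      then have "r y \<le> 2 * K * r x" using r_comparable x y by blast
      moreover have "1 * r x \<le> 2 * K * r x"
        using K_ge_1 r_pos[OF x(2)] by (intro mult_right_mono) auto
      ultimately have "\<epsilon> * max (r x) (r y) \<le> \<epsilon> * (2 * K * r x)"
        using eps by (intro mult_left_mono) auto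
      then show ?thesis using x by (intro bexI[of _ x]) (auto simp: mult_ac)
    qed
    then have "\<exists>x\<in>S. \<rho> x y < r x / (2 * K) / (2 * K)" unfolding eps(3) by simp
    then obtain x where x: "x \<in> S" "x \<in> X" "\<rho> x y < r x / (2 * K) / (2 * K)"
      using S(1) by blast
    have "0 < r x / (2 * K)" using r_pos[OF x(2)] K_ge_1 by simp
    then have "B x (r x / (2 * K) / (2 * K)) \<subseteq> V x"
      unfolding V_def by (rule ball_subset_core[OF x(2)])
    moreover have "y \<in> B x (r x / (2 * K) / (2 * K))" using x y by (simp add: qball_def)
    ultimately have "y \<in> V x" by (rule subsetD)
    then show ?thesis using x(1) by (rule bexI)
  qed
  have "open_refinement (qtopology X \<rho>) \<B> (V ` S)"
    unfolding open_refinement_def open_cover_def topspace_qtopology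
  proof (intro conjI ballI)
    have "V x \<subseteq> X" for x unfolding V_def core_def by (rule Collect_restrict)
    then show "\<Union> (V ` S) = X" using covered by blast
    show "openin (qtopology X \<rho>) W" if "W \<in> V ` S" for W
      using that openin_core unfolding V_def by blast
    fix W assume "W \<in> V ` S"
    then obtain x where x: "x \<in> S" "x \<in> X" "W = V x" using S(1) by blast
    have "1 * r x < 2 * K * r x"
      using K_ge_1 r_pos[OF x(2)] by (intro mult_strict_right_mono) auto
    then have "r x / (2 * K) < r x" using K_ge_1 by (simp add: field_simps)
    then obtain U where "U \<in> \<B>" "B x (r x / (2 * K)) \<subseteq> U"
      using ball_subset_cover[OF cover x(2), folded r_def] by blast
    then show "\<exists>U\<in>\<B>. W \<subseteq> U" using core_subset[of x "r x / (2 * K)"] x(3) unfolding V_def by blast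
  qed
  moreover have "finite {W \<in> V ` S. z \<in> W} \<and> card {W \<in> V ` S. z \<in> W} \<le> N + 1" if z: "z \<in> X" for z
  proof -
    \<comment> \<open>Counting centres bounds the number of cores, even if distinct centres have
      equal cores.\<close>
    define F where "F = {x\<in>S. z \<in> V x}"
    have F: "x \<in> X \<and> \<rho> z x < r z \<and> r z \<le> 2 * K * r x" if "x \<in> F" for x
    proof -
      have x: "x \<in> X" "\<rho> x z < r x / (2 * K)"
        using that S(1) core_subset[of x "r x / (2 * K)"] by (auto simp: F_def V_def qball_def)
      have "r x / (2 * K) \<le> max (r x) (r z) / (2 * K)"
        using K_ge_1 by (intro divide_right_mono) auto
      then have *: "\<rho> x z < max (r x) (r z) / (2 * K)" using x by linarith
      \<comment> \<open>One comparison places the centres inside \<open>B z (r z)\<close>; the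
        reverse one bounds their separation from below.\<close>
      then have "r x \<le> 2 * K * r z" using r_comparable[of x z] x z by blast
      then have "r x / (2 * K) \<le> r z" using K_ge_1 by (simp add: field_simps)
      moreover have "r z \<le> 2 * K * r x"
        using r_comparable[of z x] * x z by (simp add: sym[of z x] max.commute)
      ultimately show ?thesis using x z by (simp add: sym[of z x])
    qed
    have "separated (r z / (16 * K ^ 4)) F"
      unfolding separated_def
    proof (rule pairwiseI)
      fix x y assume xy: "x \<in> F" "y \<in> F" "x \<noteq> y"
      then have "x \<in> X" "y \<in> X" "x \<in> S" "y \<in> S" using F by (auto simp: F_def)
      then have "\<epsilon> * max (r x) (r y) \<le> \<rho> x y"
        using S(2) xy by (auto simp: pairwise_def R_def)
      moreover have "\<epsilon> * r x \<le> \<epsilon> * max (r x) (r y)" using eps by (intro mult_left_mono) auto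
      moreover have "r z / (16 * K ^ 4) = \<epsilon> * (r z / (2 * K))"
        by (simp add: \<epsilon>_def power3_eq_cube power4_eq_xxxx)
      moreover have "r z / (2 * K) \<le> r x" using F[OF xy(1)] K_ge_1 by (simp add: field_simps)
      then have "\<epsilon> * (r z / (2 * K)) \<le> \<epsilon> * r x" using eps by (intro mult_left_mono) auto
      ultimately show "r z / (16 * K ^ 4) \<le> \<rho> x y" by linarith
    qed
    moreover have "F \<subseteq> B z (r z)" using F by (auto simp: qball_def)
    ultimately have "finite F" "card F \<le> N" using bound[OF z r_pos[OF z]] by blast+
    moreover have "{W \<in> V ` S. z \<in> W} = V ` F" by (auto simp: F_def)
    ultimately show ?thesis using card_image_le[of F V] by simp
  qed
  ultimately show "\<exists>\<C>. open_refinement (qtopology X \<rho>) \<B> \<C> \<and>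
      (\<forall>x\<in>X. finite {V \<in> \<C>. x \<in> V} \<and> card {V \<in> \<C>. x \<in> V} \<le> N + 1)"
    by blast
qed

end

section \<open>Packing bounds from a doubling measure\<close>

text \<open>Real-valued \<open>measure\<close>, with finiteness carried by
  \<open>fmeasurable\<close>, keeps the volume comparison in real arithmetic.\<close>

locale doubling_quasimetric = quasimetric +
  fixes M :: "'a measure" and C :: real
  assumes ball_fmeasurable: "\<lbrakk>x \<in> X; 0 < r\<rbrakk> \<Longrightarrow> B x r \<in> fmeasurable M"
    and ball_measure_pos: "\<lbrakk>x \<in> X; 0 < r\<rbrakk> \<Longrightarrow> 0 < measure M (B x r)"
    and doubling: "\<lbrakk>x \<in> X; 0 < r\<rbrakk> \<Longrightarrow> measure M (B x (2 * r)) \<le> C * measure M (B x r)"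
    and C_ge_1: "1 \<le> C"
begin

lemma doubling_power:
  assumes "x \<in> X" "0 < r"
  shows "measure M (B x (2 ^ m * r)) \<le> C ^ m * measure M (B x r)"
proof (induction m)
  case (Suc m)
  have "measure M (B x (2 * (2 ^ m * r))) \<le> C * measure M (B x (2 ^ m * r))"
    using assms by (intro doubling) auto
  also have "\<dots> \<le> C * (C ^ m * measure M (B x r))"
    using Suc C_ge_1 by (intro mult_left_mono) auto
  finally show ?case by (simp add: mult_ac)
qed simp

text \<open>Volume packing: the balls \<open>B x s\<close> are disjoint by separation, lie in one
  ball \<open>Z\<close>, and each has at least the fraction \<open>1 / C ^ m\<close> of its measure,
  as \<open>scale\<close> puts \<open>Z\<close> inside \<open>B x (2 ^ m * s)\<close>.\<close>

lemma finite_separated_card_le: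
  assumes z: "z \<in> X" and "0 < s" "0 < t"
    and scale: "K * (t + K * (t + s)) \<le> 2 ^ m * s"
    and F: "finite F" "F \<subseteq> B z t" "separated (2 * K * s) F"
  shows "card F \<le> C ^ m"
proof -
  define Z where "Z = B z (K * (t + s))"
  have Z_pos: "0 < measure M Z" and Z_fm: "Z \<in> fmeasurable M"
    unfolding Z_def using assms K_ge_1 by (auto intro!: ball_measure_pos ball_fmeasurable)
  have in_X: "x \<in> X" "\<rho> z x \<le> t" if "x \<in> F" for x
    using that F(2) by (auto simp: qball_def)
  have "measure M Z \<le> C ^ m * measure M (B x s)" if x: "x \<in> F" for x
  proof -
    have "K * (\<rho> x z + K * (t + s)) \<le> K * (t + K * (t + s))"
      using in_X[OF x] z K_ge_1 by (intro mult_left_mono) (auto simp: sym)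
    then have "Z \<subseteq> B x (2 ^ m * s)"
      unfolding Z_def using in_X[OF x] z scale by (intro ball_subset_ball) auto
    then have "measure M Z \<le> measure M (B x (2 ^ m * s))"
      using in_X[OF x] \<open>0 < s\<close> Z_fm
      by (intro measure_mono_fmeasurable ball_fmeasurable) (auto dest: fmeasurableD)
    also have "\<dots> \<le> C ^ m * measure M (B x s)"
      using in_X(1)[OF x] \<open>0 < s\<close> by (rule doubling_power)
    finally show ?thesis .
  qed
  then have "(\<Sum>x\<in>F. measure M Z) \<le> (\<Sum>x\<in>F. C ^ m * measure M (B x s))"
    by (rule sum_mono)
  then have "card F * measure M Z \<le> C ^ m * (\<Sum>x\<in>F. measure M (B x s))"
    by (simp add: sum_distrib_left)
  also have "(\<Sum>x\<in>F. measure M (B x s)) = measure M (\<Union>x\<in>F. B x s)"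
  proof (rule measure_UNION'[symmetric])
    show "pairwise (\<lambda>x y. disjnt (B x s) (B y s)) F"
    proof (rule pairwiseI)
      fix x y assume xy: "x \<in> F" "y \<in> F" "x \<noteq> y"
      have False if "w \<in> B x s" "w \<in> B y s" for w
      proof -
        have w: "w \<in> X" "\<rho> x w < s" "\<rho> w y < s"
          using that in_X[OF xy(2)] by (auto simp: qball_def sym)
        have "\<rho> x y \<le> K * (\<rho> x w + \<rho> w y)" using in_X xy w by (intro triangle) auto
        also have "\<dots> < K * (2 * s)" using w K_ge_1 by (intro mult_strict_left_mono) auto
        also have "\<dots> \<le> \<rho> x y" using F(3) xy by (simp add: separated_def pairwise_def mult_ac)
        finally show False by simp
      qed
      then show "disjnt (B x s) (B y s)" by (auto simp: disjnt_def)
    qed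
  qed (use F in_X \<open>0 < s\<close> in \<open>auto intro: ball_fmeasurable\<close>)
  also have "measure M (\<Union>x\<in>F. B x s) \<le> measure M Z"
  proof (rule measure_mono_fmeasurable[OF _ _ Z_fm])
    show "(\<Union>x\<in>F. B x s) \<in> sets M"
      using F in_X \<open>0 < s\<close> by (intro sets.finite_UN) (auto intro: fmeasurableD ball_fmeasurable)
    show "(\<Union>x\<in>F. B x s) \<subseteq> Z"
    proof (rule UN_least)
      fix x assume "x \<in> F"
      then show "B x s \<subseteq> Z"
        unfolding Z_def using in_X z K_ge_1 by (intro ball_subset_ball mult_left_mono) auto
    qed
  qed
  finally have "card F * measure M Z \<le> C ^ m * measure M Z"
    using C_ge_1 by simp
  then show ?thesis using Z_pos by simp
qed

text \<open>The condition \<open>scale\<close> is homogeneous: with \<open>s = t * c\<close> it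
  reduces to \<open>t = 1\<close>, so one \<open>m\<close>, and hence one \<open>N\<close>, serves
  all centres and radii.\<close>

lemma separated_bound:
  assumes "0 < b"
  obtains N where "\<And>z t F. \<lbrakk>z \<in> X; 0 < t; F \<subseteq> B z t; separated (t * b) F\<rbrakk>
      \<Longrightarrow> finite F \<and> card F \<le> N"
proof -
  define c where "c = b / (2 * K)"
  have c: "c > 0" "2 * K * c = b" using assms K_ge_1 by (auto simp: c_def)
  obtain m where "K * (1 + K * (1 + c)) / c < 2 ^ m" using real_arch_pow[of 2] by auto
  then have m: "K * (1 + K * (1 + c)) \<le> 2 ^ m * c" using c by (simp add: field_simps)
  have "finite F \<and> card F \<le> nat \<lfloor>C ^ m\<rfloor>"
    if F: "z \<in> X" "0 < t" "F \<subseteq> B z t" "separated (t * b) F" for z t F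
  \<comment> \<open>\<open>F\<close> may be infinite a priori; a uniform bound on its finite subsets
    gives finiteness and the cardinality bound together.\<close>
  proof (rule finite_if_finite_subsets_card_bdd)
    fix G assume G: "G \<subseteq> F" "finite G"
    have "separated (2 * K * (t * c)) G"
      using F(4) G(1) c(2) by (auto simp: separated_def mult_ac intro: pairwise_subset)
    moreover have "K * (t + K * (t + t * c)) \<le> 2 ^ m * (t * c)"
      using mult_left_mono[OF m, of t] F(2) by (simp add: algebra_simps)
    ultimately have "card G \<le> C ^ m"
      using F G c by (intro finite_separated_card_le[of z "t * c" t]) auto
    then show "card G \<le> nat \<lfloor>C ^ m\<rfloor>" by linarith
  qed
  then show thesis using that by blast
qed

lemma covering_dim_le_ex: "\<exists>N. covering_dim_le (qtopology X \<rho>) N"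
proof -
  have "0 < 1 / (16 * K ^ 4)" using K_ge_1 by simp
  then obtain N where "\<And>z t F. \<lbrakk>z \<in> X; 0 < t; F \<subseteq> B z t; separated (t * (1 / (16 * K ^ 4))) F\<rbrakk>
      \<Longrightarrow> finite F \<and> card F \<le> N"
    using separated_bound by blast
  then have "covering_dim_le (qtopology X \<rho>) N"
    by (intro covering_dim_le_of_separated_bound) auto
  then show ?thesis ..
qed

end

section \<open>From homogeneity to finite covering dimension\<close>

lemma cw_homogeneous_doubling_quasimetric:
  assumes "cw_homogeneous X \<rho> M"
  obtains K C where "doubling_quasimetric X \<rho> K M C"
proof -
  have Q: "quasimetric_on X \<rho>" using assms by (simp add: cw_homogeneous_def)
  then obtain K where "K \<ge> 1" "\<forall>x\<in>X. \<forall>y\<in>X. \<forall>z\<in>X. \<rho> x y \<le> K * (\<rho> x z + \<rho> z y)"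
    unfolding quasimetric_on_def by (elim conjE exE)
  then have K: "quasimetric X \<rho> K"
    using Q by unfold_locales (auto simp: quasimetric_on_def)
  have "\<exists>C::real. C \<ge> 1 \<and> (\<forall>x\<in>X. \<forall>r>0.
      emeasure M (qball X \<rho> x (2 * r)) \<le> ennreal C * emeasure M (qball X \<rho> x r))"
    using assms by (simp add: cw_homogeneous_def)
  then obtain C where C: "C \<ge> 1" and dbl: "\<forall>x\<in>X. \<forall>r>0.
      emeasure M (qball X \<rho> x (2 * r)) \<le> ennreal C * emeasure M (qball X \<rho> x r)"
    by (elim conjE exE)
  have meas: "qball X \<rho> x r \<in> sets M" "0 < emeasure M (qball X \<rho> x r)"
      "emeasure M (qball X \<rho> x r) < \<infinity>" if "x \<in> X" "r > 0" for x r
    using assms that by (simp_all add: cw_homogeneous_def)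
  \<comment> \<open>Finite ball measures allow the doubling inequality to pass from extended to real
    values.\<close>
  have em: "emeasure M (qball X \<rho> x r) = ennreal (measure M (qball X \<rho> x r))"
    if "x \<in> X" "r > 0" for x r
    using meas(3)[OF that] by (intro emeasure_eq_ennreal_measure) auto
  have "doubling_quasimetric_axioms X \<rho> M C"
  proof
    fix x and r :: real assume x: "x \<in> X" "0 < r"
    show "qball X \<rho> x r \<in> fmeasurable M" using meas[OF x] by (intro fmeasurableI) auto
    show "0 < measure M (qball X \<rho> x r)" using meas(2)[OF x] em[OF x] by simp
    show "measure M (qball X \<rho> x (2 * r)) \<le> C * measure M (qball X \<rho> x r)"
    proof -
      have "ennreal (measure M (qball X \<rho> x (2 * r))) \<le> ennreal C * ennreal (measure M (qball X \<rho> x r))"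
        using dbl[rule_format, OF x] em[OF x] em[of x "2 * r"] x by simp
      also have "\<dots> = ennreal (C * measure M (qball X \<rho> x r))"
        using C by (intro ennreal_mult[symmetric]) auto
      finally show ?thesis using C by simp
    qed
  qed (rule C)
  with K show thesis using that by (auto simp: doubling_quasimetric_def)
qed

theorem theorem1p1:
  fixes T :: "'a topology"
  assumes "topspace T \<noteq> {}"
    and "covering_dim T = \<infinity>"
  shows "\<not> (\<exists>(\<rho> :: 'a \<Rightarrow> 'a \<Rightarrow> real) (M :: 'a measure).
    quasimetric_on (topspace T) \<rho> \<and>
    borel_measure_on T M \<and>
    qtopology (topspace T) \<rho> = T \<and>
    cw_homogeneous (topspace T) \<rho> M)"
proof
  assume "\<exists>(\<rho> :: 'a \<Rightarrow> 'a \<Rightarrow> real) (M :: 'a measure).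
    quasimetric_on (topspace T) \<rho> \<and>
    borel_measure_on T M \<and>
    qtopology (topspace T) \<rho> = T \<and>
    cw_homogeneous (topspace T) \<rho> M"
  then obtain \<rho> :: "'a \<Rightarrow> 'a \<Rightarrow> real" and M :: "'a measure"
    where T: "qtopology (topspace T) \<rho> = T" and "cw_homogeneous (topspace T) \<rho> M"
    by blast
  then obtain K C where "doubling_quasimetric (topspace T) \<rho> K M C"
    using cw_homogeneous_doubling_quasimetric by blast
  then have "\<exists>N. covering_dim_le T N"
    using doubling_quasimetric.covering_dim_le_ex T by metis
  \<comment> \<open>A bound \<open>N\<close> selects the \<open>enat\<close> branch of
    \<open>covering_dim\<close>, which is never \<infinity>.\<close>
  with assms(2) show False by (auto simp: covering_dim_def split: if_splits)
qed

end
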